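(* For every integer $n \geq 1$, the Euler numbers $E_{2j}$ satisfy $$\sum_{j=0}^{n} \binom{2n}{2j}\, E_{2j} = 0.$$
   Context: The Euler numbers $(E_n)_{n\ge 0}$ are the unique sequence of numbers satisfying $$\frac{2}{e^x+e^{-x}} = \sum_{n=0}^{\infty} \frac{E_n}{n!}\,x^n .$$ *)

theory Defs
  imports "HOL-Analysis.Analysis"
begin

text \<open>
  The generating identity is read as one between formal power series; \<open>fps_exp c\<close> is the series
  of $e^{cx}$, and the denominator is a unit because its constant coefficient is 2.
\<close>

definition euler_number :: "nat \<Rightarrow> real" where
  "euler_number n = fact n * fps_nth (2 / (fps_exp 1 + fps_exp (-1))) n"

lemma euler_number_unique:
  fixes E :: "nat \<Rightarrow> real"
  shows "2 / (fps_exp 1 + fps_exp (-1)) = Abs_fps (\<lambda>n. E n / fact n) \<longleftrightarrow> E = euler_number"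
  by (auto simp: fps_eq_iff euler_number_def fun_eq_iff field_simps)

text \<open>The identity also holds between functions near 0.\<close>

lemma euler_number_has_fps_expansion:
  "(\<lambda>x::real. 2 / (exp x + exp (-x))) has_fps_expansion Abs_fps (\<lambda>n. euler_number n / fact n)"
proof -
  have "(\<lambda>x::real. 2 / (exp (1 * x) + exp (-1 * x))) has_fps_expansion
          2 / (fps_exp 1 + fps_exp (-1))"
    by (intro has_fps_expansion_divide' has_fps_expansion_add has_fps_expansion_exp
          has_fps_expansion_numeral) auto
  then show ?thesis
    using euler_number_unique[of euler_number] by simp
qed

end

theory Submission
  imports Defs
begin

text \<open>
  Compare the coefficients of $x^{2n}$ in $\left(\sum_i E_i x^i / i!\right)(e^x + e^{-x}) = 2$.
  In even degree the coefficients of $e^x + e^{-x}$ annihilate the terms of odd index, so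
  nothing about the odd Euler numbers is needed.
\<close>

lemma euler_number_fps_mult:
  "Abs_fps (\<lambda>n. euler_number n / fact n) * (fps_exp 1 + fps_exp (-1)) = 2"
proof -
  have "fps_nth (fps_exp 1 + fps_exp (-1) :: real fps) 0 \<noteq> 0"
    by simp
  then have "2 / (fps_exp 1 + fps_exp (-1)) * (fps_exp 1 + fps_exp (-1)) = (2 :: real fps)"
    by (simp add: fps_divide_unit inverse_mult_eq_1 mult.assoc)
  then show ?thesis
    using euler_number_unique[of euler_number] by metis
qed

text \<open>The induction step splits off the indices \<open>2*n + 1\<close> and
  \<open>2*n + 2\<close>; the first is odd and contributes 0.\<close>

lemma sum_even_indices:
  fixes f :: "nat \<Rightarrow> 'a::comm_monoid_add"
  assumes "\<And>i. \<lbrakk>odd i; i < 2*n\<rbrakk> \<Longrightarrow> f i = 0"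
  shows "(\<Sum>i=0..2*n. f i) = (\<Sum>j=0..n. f (2*j))"
  using assms by (induction n) simp_all

theorem theorem1p2:
  fixes n :: nat
  assumes "n \<ge> 1"
  shows "(\<Sum>j=0..n. real ((2 * n) choose (2 * j)) * euler_number (2 * j)) = 0"
proof -
  \<comment> \<open>The Cauchy product term in degree \<open>2*n\<close>:
    \<open>(1 + (-1)^k) / fact k\<close> is coefficient \<open>k\<close> of the series of e^x +
    e^(-x).\<close>
  define g where
    "g i = euler_number i / fact i * ((1 + (-1) ^ (2*n - i)) / fact (2*n - i))" for i
  \<comment> \<open>At even indices \<open>1 + (-1)^(2*n - 2*j)\<close> is 2, hence the division by
    2; \<open>fact (2*n)\<close> completes the binomial coefficient.\<close>
  have even_term: "real (2*n choose (2*j)) * euler_number (2*j) = fact (2*n) / 2 * g (2*j)"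
    if "j \<in> {0..n}" for j
  proof -
    have "2*n - 2*j = 2 * (n - j)"
      by simp
    then have "(-1::real) ^ (2*n - 2*j) = 1"
      by simp
    then show ?thesis
      using that by (simp add: g_def binomial_fact field_simps)
  qed
  have "(\<Sum>i=0..2*n. g i) =
      fps_nth (Abs_fps (\<lambda>n. euler_number n / fact n) * (fps_exp 1 + fps_exp (-1))) (2*n)"
    by (simp add: fps_mult_nth g_def add_divide_distrib)
  \<comment> \<open>The product is the constant series 2, and \<open>n \<ge> 1\<close> makes the
    degree \<open>2*n\<close> positive.\<close>
  also have "\<dots> = 0"
    using assms by (simp add: euler_number_fps_mult fps_numeral_nth)
  finally have total: "(\<Sum>i=0..2*n. g i) = 0" .
  \<comment> \<open>Here \<open>2*n - i\<close> is odd, so the two exponentials cancel in that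
    degree.\<close>
  have "g i = 0" if "odd i" "i < 2*n" for i
    using that by (simp add: g_def)
  then have "(\<Sum>j=0..n. g (2*j)) = 0"
    using total by (simp add: sum_even_indices)
  then have "(\<Sum>j=0..n. fact (2*n) / 2 * g (2*j)) = 0"
    by (simp only: sum_distrib_left[symmetric] mult_zero_right)
  then show ?thesis
    by (simp only: even_term cong: sum.cong)
qed

end
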